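(* For every integer $k\ge1$, the Möbius ladder $Mob_{3k}$ has a lacunar 3-total-perfect semi-total coloring (sTC) $\mu$ for which there is no $\beta$-reduction of $\mu$ to a total coloring (TC). Moreover, such $\mu$ is equitable if and only if $k=1$. Thus, $K_{3,3}=Mob_3$ is the only Möbius ladder with a lacunar 3-total-perfect sTC that is equitable.
   Context: For an integer $r>2$ the Möbius ladder $Mob_r$ is the graph obtained from the cycle $C_{2r}$ by adding the edges joining opposite vertices. Colorings. For a cubic graph $G$ a set of four colors $\chi(3)=\{0,1,2,3\}$ is used. A semi-total coloring (sTC) of $G$ is a function $\mu:V(G)\cup E(G)\to\chi(3)$ such that every two adjacent edges have distinct colors and every vertex has a color distinct from the colors of its incident edges. A total coloring (TC) is an sTC in which, in addition, adjacent vertices have distinct colors. The $\mu$-class of a color is the set of vertices and edges with that color; $\mu$ is equitable if the cardinalities of every two of the four $\mu$-classes differ by at most 1. An sTC is lacunar if some color $c\in\chi(3)$ is assigned to no vertex. A $\beta$-edge of $\mu$ is an edge whose endvertices have the same color; $\beta(\mu)$ is the number of $\beta$-edges. A total perfect code of a graph $G=(V,E)$ is a set $S\subseteq V$ such that $|N(v)\cap S|=1$ for all $v\in V$, where $N(v)$ is the open neighborhood of $v$. A lacunar sTC $\mu$ of a cubic graph is 3-total-perfect if the vertex sets of the nonempty color classes (of vertices) form three total perfect codes formed by the endvertices of the $\beta$-edges. $\beta$-reductions. A color alternating path with respect to $\mu$ is a path $S=(v_0,e_1,v_1,\ldots,e_k,v_k)$ in $G$ (of some length $k\geq1$) for which there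 are distinct colors $c_0,c_1$ with $\mu(v_0)=c_0$, $\mu(e_i)=c_1$ for odd $i$, $\mu(e_i)=c_0$ for even $i$, and $\mu(v_k)\in\{c_0,c_1\}\setminus\{\mu(e_k)\}$ (colors of interior vertices are arbitrary). It is a maximal color alternating path (MCAP) if no path having $S$ as a shorter subpath is a color alternating path with respect to $\mu$. Given an MCAP $S$, let $\mu'$ be the sTC obtained from $\mu$ by exchanging the colors $c_0$ and $c_1$ on $v_0,e_1,e_2,\ldots,e_k,v_k$ and leaving all other colors unchanged. If $\beta(\mu')\le\beta(\mu)$, then $\mu'$ is a $\beta$-reduction of $\mu$ (with respect to $S$), called partial if $\beta(\mu')>0$ and total if $\beta(\mu')=0$; in the latter case $\mu'$ is a TC. *)

theory Defs
  imports Main "HOL-Library.FuncSet" "HOL-Library.Sublist"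
begin

text \<open>A finite simple graph is a pair of a vertex set and a set of two-element subsets of it.\<close>

type_synonym 'a sgraph = "'a set \<times> 'a set set"

abbreviation verts :: "'a sgraph \<Rightarrow> 'a set" where
  "verts G \<equiv> fst G"

abbreviation edges :: "'a sgraph \<Rightarrow> 'a set set" where
  "edges G \<equiv> snd G"

definition nbhd :: "'a sgraph \<Rightarrow> 'a \<Rightarrow> 'a set" where
  "nbhd G v = {w \<in> verts G. {v, w} \<in> edges G}"

definition graph_iso :: "'a sgraph \<Rightarrow> 'b sgraph \<Rightarrow> bool" where
  "graph_iso G H \<longleftrightarrow> (\<exists>f. bij_betw f (verts G) (verts H) \<and>
     (\<forall>u\<in>verts G. \<forall>v\<in>verts G. {u, v} \<in> edges G \<longleftrightarrow> {f u, f v} \<in> edges H))"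

definition complete_bipartite :: "nat \<Rightarrow> nat \<Rightarrow> (nat + nat) sgraph" where
  "complete_bipartite m n = ({..<m} <+> {..<n}, {{Inl i, Inr j} | i j. i < m \<and> j < n})"

text \<open>Only meaningful for \<open>r > 2\<close>.\<close>

definition Mob :: "nat \<Rightarrow> nat sgraph" where
  "Mob r = ({..<2 * r},
     {{i, (i + 1) mod (2 * r)} | i. i < 2 * r} \<union> {{i, i + r} | i. i < r})"

text \<open>
  A coloring is a function on the disjoint sum of vertices and edges:
  \<open>Inl v\<close> stands for the vertex \<open>v\<close>, \<open>Inr e\<close> for the edge \<open>e\<close>.
  Its values outside \<open>elems G\<close> are irrelevant.
\<close>

type_synonym 'a coloring = "'a + 'a set \<Rightarrow> nat"

definition elems :: "'a sgraph \<Rightarrow> ('a + 'a set) set" where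
  "elems G = verts G <+> edges G"

definition colors :: "nat set" where
  "colors = {0, 1, 2, 3}"

definition semi_total_coloring :: "'a sgraph \<Rightarrow> 'a coloring \<Rightarrow> bool" where
  "semi_total_coloring G \<mu> \<longleftrightarrow> \<mu> \<in> elems G \<rightarrow> colors \<and>
     (\<forall>e\<in>edges G. \<forall>f\<in>edges G. e \<noteq> f \<and> e \<inter> f \<noteq> {} \<longrightarrow> \<mu> (Inr e) \<noteq> \<mu> (Inr f)) \<and>
     (\<forall>e\<in>edges G. \<forall>v\<in>e. \<mu> (Inl v) \<noteq> \<mu> (Inr e))"

definition total_coloring :: "'a sgraph \<Rightarrow> 'a coloring \<Rightarrow> bool" where
  "total_coloring G \<mu> \<longleftrightarrow> semi_total_coloring G \<mu> \<and>
     (\<forall>u\<in>verts G. \<forall>v\<in>verts G. {u, v} \<in> edges G \<longrightarrow> \<mu> (Inl u) \<noteq> \<mu> (Inl v))"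

definition color_class :: "'a sgraph \<Rightarrow> 'a coloring \<Rightarrow> nat \<Rightarrow> ('a + 'a set) set" where
  "color_class G \<mu> c = {x \<in> elems G. \<mu> x = c}"

definition equitable :: "'a sgraph \<Rightarrow> 'a coloring \<Rightarrow> bool" where
  "equitable G \<mu> \<longleftrightarrow> (\<forall>c\<in>colors. \<forall>d\<in>colors.
     card (color_class G \<mu> c) \<le> card (color_class G \<mu> d) + 1)"

definition vertex_class :: "'a sgraph \<Rightarrow> 'a coloring \<Rightarrow> nat \<Rightarrow> 'a set" where
  "vertex_class G \<mu> c = {v \<in> verts G. \<mu> (Inl v) = c}"

definition lacunar :: "'a sgraph \<Rightarrow> 'a coloring \<Rightarrow> bool" where
  "lacunar G \<mu> \<longleftrightarrow> semi_total_coloring G \<mu> \<and> (\<exists>c\<in>colors. vertex_class G \<mu> c = {})"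

definition beta_edges :: "'a sgraph \<Rightarrow> 'a coloring \<Rightarrow> 'a set set" where
  "beta_edges G \<mu> = {e \<in> edges G. \<forall>u\<in>e. \<forall>v\<in>e. \<mu> (Inl u) = \<mu> (Inl v)}"

definition beta :: "'a sgraph \<Rightarrow> 'a coloring \<Rightarrow> nat" where
  "beta G \<mu> = card (beta_edges G \<mu>)"

definition total_perfect_code :: "'a sgraph \<Rightarrow> 'a set \<Rightarrow> bool" where
  "total_perfect_code G S \<longleftrightarrow> S \<subseteq> verts G \<and> (\<forall>v\<in>verts G. card (nbhd G v \<inter> S) = 1)"

text \<open>
  Each code is the union of the \<open>\<beta>\<close>-edges contained in it, that is, the set of their endvertices.
\<close>

definition three_total_perfect :: "'a sgraph \<Rightarrow> 'a coloring \<Rightarrow> bool" where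
  "three_total_perfect G \<mu> \<longleftrightarrow> lacunar G \<mu> \<and>
     (let \<C> = vertex_class G \<mu> ` colors - {{}} in
        card \<C> = 3 \<and>
        (\<forall>S\<in>\<C>. total_perfect_code G S \<and> S = \<Union>{e \<in> beta_edges G \<mu>. e \<subseteq> S}))"

text \<open>
  As graphs are simple, a path \<open>(v\<^sub>0, e\<^sub>1, v\<^sub>1, \<dots>, e\<^sub>k, v\<^sub>k)\<close> is given by the list of its vertices.
  Its edges are numbered from \<open>0\<close> here, so that \<open>path_edge p i\<close> is \<open>e\<^bsub>i+1\<^esub>\<close>.
\<close>

definition path_edge :: "'a list \<Rightarrow> nat \<Rightarrow> 'a set" where
  "path_edge p i = {p ! i, p ! (i + 1)}"

definition is_path :: "'a sgraph \<Rightarrow> 'a list \<Rightarrow> bool" where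
  "is_path G p \<longleftrightarrow> length p \<ge> 2 \<and> distinct p \<and> set p \<subseteq> verts G \<and>
     (\<forall>i < length p - 1. path_edge p i \<in> edges G)"

definition alternating_path :: "'a sgraph \<Rightarrow> 'a coloring \<Rightarrow> nat \<Rightarrow> nat \<Rightarrow> 'a list \<Rightarrow> bool" where
  "alternating_path G \<mu> c0 c1 p \<longleftrightarrow> is_path G p \<and> c0 \<noteq> c1 \<and>
     \<mu> (Inl (hd p)) = c0 \<and>
     (\<forall>i < length p - 1. \<mu> (Inr (path_edge p i)) = (if even i then c1 else c0)) \<and>
     \<mu> (Inl (last p)) \<in> {c0, c1} - {\<mu> (Inr (path_edge p (length p - 2)))}"

text \<open>
  The reverse of an alternating path is alternating, so it suffices to consider longer paths
  that traverse \<open>p\<close> in the same direction.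
\<close>

definition maximal_alternating_path ::
    "'a sgraph \<Rightarrow> 'a coloring \<Rightarrow> nat \<Rightarrow> nat \<Rightarrow> 'a list \<Rightarrow> bool" where
  "maximal_alternating_path G \<mu> c0 c1 p \<longleftrightarrow> alternating_path G \<mu> c0 c1 p \<and>
     \<not> (\<exists>q d0 d1. strict_sublist p q \<and> alternating_path G \<mu> d0 d1 q)"

text \<open>Inner vertices of the path keep their colors.\<close>

definition swap_elems :: "'a list \<Rightarrow> ('a + 'a set) set" where
  "swap_elems p = {Inl (hd p), Inl (last p)} \<union> {Inr (path_edge p i) | i. i < length p - 1}"

definition exchange :: "'a coloring \<Rightarrow> nat \<Rightarrow> nat \<Rightarrow> 'a list \<Rightarrow> 'a coloring" where
  "exchange \<mu> c0 c1 p = (\<lambda>x. if x \<in> swap_elems p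
     then (if \<mu> x = c0 then c1 else if \<mu> x = c1 then c0 else \<mu> x) else \<mu> x)"

definition beta_reduction :: "'a sgraph \<Rightarrow> 'a coloring \<Rightarrow> 'a coloring \<Rightarrow> bool" where
  "beta_reduction G \<mu> \<mu>' \<longleftrightarrow> (\<exists>c0 c1 p. maximal_alternating_path G \<mu> c0 c1 p \<and>
     \<mu>' = exchange \<mu> c0 c1 p \<and> beta G \<mu>' \<le> beta G \<mu>)"

end

theory Submission
  imports Defs
begin

text \<open>
  Everything rests on one count. In a cubic graph the colors of a vertex and of its three edges are
  four distinct colors, so every color \<open>d\<close> appears exactly once at every vertex. Hence, if \<open>V\<^sub>d\<close> and
  \<open>E\<^sub>d\<close> are the vertices and edges of color \<open>d\<close> and \<open>n\<close> is the number of vertices,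
  \<open>card V\<^sub>d + 2 * card E\<^sub>d = n\<close>. A total perfect code contains one of the three neighbors of
  each vertex, so it has \<open>n / 3\<close> elements. A 3-total-perfect coloring therefore has a color class
  with \<open>n / 2\<close> elements, for the color missing on the vertices, and three with \<open>2 * n / 3\<close>
  elements; this is equitable iff \<open>n = 6\<close> (\<open>three_total_perfect_equitable_iff\<close>).

  A \<open>\<beta>\<close>-reduction changes the colors of no vertices but the two ends of a path, and these
  meet at most two of the three codes.
  The \<open>\<beta>\<close>-edges of the third code survive, so no 3-total-perfect coloring of any graph has a
  \<open>\<beta>\<close>-reduction to a total coloring (\<open>no_beta_reduction_to_total_coloring\<close>).

  What remains is to find a coloring. A vertex coloring with three colors that is rainbow on all
  neighborhoods extends to the edges: a \<open>\<beta>\<close>-edge gets the fourth color and any other edge the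
  one of the three colors that neither of its ends has (\<open>three_total_perfect_rainbow_extension\<close>). On the ladder with
  \<open>6 * k\<close> vertices, the residue modulo 3 is such a vertex coloring: the neighbors of \<open>v\<close> are
  \<open>v + 1\<close>, \<open>v - 1\<close> and \<open>v + 3 * k\<close>, modulo \<open>6 * k\<close>.
\<close>

section \<open>Cubic graphs\<close>

definition cubic_graph :: "'a sgraph \<Rightarrow> bool" where
  "cubic_graph G \<longleftrightarrow> finite (verts G) \<and>
     (\<forall>e\<in>edges G. \<exists>u\<in>verts G. \<exists>v\<in>verts G. u \<noteq> v \<and> e = {u, v}) \<and>
     (\<forall>v\<in>verts G. card (nbhd G v) = 3)"

lemma cubic_graph_edgeE:
  assumes "cubic_graph G" "e \<in> edges G" "v \<in> e"
  obtains w where "e = {v, w}" "v \<in> verts G" "w \<in> nbhd G v" "w \<noteq> v"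
proof -
  obtain a b where ab: "a \<in> verts G" "b \<in> verts G" "a \<noteq> b" "e = {a, b}"
    using assms unfolding cubic_graph_def by blast
  show ?thesis
    using ab assms(2,3) that[of a] that[of b] by (auto simp: nbhd_def insert_commute)
qed

lemma cubic_graph_finite_edges:
  assumes "cubic_graph G"
  shows "finite (edges G)"
proof (rule finite_subset)
  show "edges G \<subseteq> Pow (verts G)" using assms by (fastforce simp: cubic_graph_def)
  show "finite (Pow (verts G))" using assms by (simp add: cubic_graph_def)
qed

lemma cubic_graph_card_incident:
  assumes G: "cubic_graph G" and v: "v \<in> verts G"
  shows "card {e \<in> edges G. v \<in> e} = 3"
proof -
  have "{e \<in> edges G. v \<in> e} = (\<lambda>w. {v, w}) ` nbhd G v"
    by (auto simp: nbhd_def elim!: cubic_graph_edgeE[OF G])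
  moreover have "inj_on (\<lambda>w. {v, w}) (nbhd G v)"
    by (auto simp: inj_on_def doubleton_eq_iff)
  ultimately show ?thesis
    using assms by (simp add: card_image cubic_graph_def)
qed

lemma cubic_graph_handshake:
  assumes G: "cubic_graph G" and F: "F \<subseteq> edges G"
  shows "(\<Sum>v\<in>verts G. card {e \<in> F. v \<in> e}) = 2 * card F"
proof (rule sum_multicount)
  show "finite (verts G)" using G by (simp add: cubic_graph_def)
  show "finite F" using F cubic_graph_finite_edges[OF G] finite_subset by blast
  show "\<forall>e\<in>F. card {v \<in> verts G. v \<in> e} = 2"
  proof
    fix e assume "e \<in> F"
    then obtain a b where "a \<in> verts G" "b \<in> verts G" "a \<noteq> b" "e = {a, b}"
      using G F unfolding cubic_graph_def by blast
    then have "{v \<in> verts G. v \<in> e} = {a, b}" "a \<noteq> b" by auto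
    then show "card {v \<in> verts G. v \<in> e} = 2" by simp
  qed
qed

section \<open>Sizes of color classes\<close>

text \<open>
  The three edges at \<open>v\<close> have distinct colors among the three colors other than that of \<open>v\<close>,
  so they use all of these.
\<close>

lemma every_color_once_at_vertex:
  assumes G: "cubic_graph G" and \<mu>: "semi_total_coloring G \<mu>"
    and v: "v \<in> verts G" and d: "d \<in> colors"
  shows "card {e \<in> edges G. \<mu> (Inr e) = d \<and> v \<in> e} + (if \<mu> (Inl v) = d then 1 else 0) = 1"
proof -
  define I where "I = {e \<in> edges G. v \<in> e}"
  have inj: "inj_on (\<lambda>e. \<mu> (Inr e)) I"
  proof (rule inj_onI)
    fix e f assume "e \<in> I" "f \<in> I" "\<mu> (Inr e) = \<mu> (Inr f)"
    moreover from this have "e \<inter> f \<noteq> {}" by (auto simp: I_def)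
    ultimately show "e = f" using \<mu> by (auto simp: semi_total_coloring_def I_def)
  qed
  have sub: "(\<lambda>e. \<mu> (Inr e)) ` I \<subseteq> colors - {\<mu> (Inl v)}"
  proof (rule image_subsetI)
    fix e assume "e \<in> I"
    then have "e \<in> edges G" "v \<in> e" by (auto simp: I_def)
    moreover from this(1) have "Inr e \<in> elems G" by (auto simp: elems_def)
    ultimately show "\<mu> (Inr e) \<in> colors - {\<mu> (Inl v)}"
      using \<mu> unfolding semi_total_coloring_def Pi_iff by force
  qed
  have "\<mu> (Inl v) \<in> colors"
    using \<mu> v by (auto simp: semi_total_coloring_def elems_def)
  then have "card (colors - {\<mu> (Inl v)}) = 3" "finite colors"
    by (auto simp: colors_def)
  moreover have "card ((\<lambda>e. \<mu> (Inr e)) ` I) = 3"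
    using cubic_graph_card_incident[OF G v] inj by (simp add: card_image I_def)
  ultimately have img: "(\<lambda>e. \<mu> (Inr e)) ` I = colors - {\<mu> (Inl v)}"
    using sub by (intro card_subset_eq) auto
  show ?thesis
  proof (cases "\<mu> (Inl v) = d")
    case True
    then have "{e \<in> edges G. \<mu> (Inr e) = d \<and> v \<in> e} = {}"
      using img by (auto simp: I_def)
    then show ?thesis using True by (simp only: card.empty if_True simp_thms add_0)
  next
    case False
    then obtain e where e: "e \<in> I" "\<mu> (Inr e) = d"
      using img d by (metis (no_types, lifting) Diff_iff imageE singletonD)
    then have "{e \<in> edges G. \<mu> (Inr e) = d \<and> v \<in> e} = {e}"
      using inj by (auto simp: I_def inj_on_def)
    then show ?thesis using False by (simp only: card_1_singleton_iff) simp
  qed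
qed

text \<open>
  This is \<open>card V\<^sub>d + 2 * card E\<^sub>d = n\<close>, with \<open>E\<^sub>d\<close> eliminated in favor of the whole class of \<open>d\<close>.
\<close>

lemma double_card_color_class:
  assumes G: "cubic_graph G" and \<mu>: "semi_total_coloring G \<mu>" and d: "d \<in> colors"
  shows "2 * card (color_class G \<mu> d) = card (verts G) + card (vertex_class G \<mu> d)"
proof -
  define F where "F = {e \<in> edges G. \<mu> (Inr e) = d}"
  have fin: "finite (verts G)" "finite F"
    using G cubic_graph_finite_edges[OF G] by (auto simp: cubic_graph_def F_def)
  have "card (verts G)
      = (\<Sum>v\<in>verts G. card {e \<in> F. v \<in> e} + (if \<mu> (Inl v) = d then 1 else 0))"
    using every_color_once_at_vertex[OF G \<mu> _ d] by (simp add: F_def conj_assoc)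
  also have "\<dots> = 2 * card F + card (vertex_class G \<mu> d)"
    using cubic_graph_handshake[OF G, of F] fin
    by (simp add: sum.distrib F_def vertex_class_def sum.If_cases Int_def)
  finally have n: "card (verts G) = 2 * card F + card (vertex_class G \<mu> d)" .
  have "color_class G \<mu> d = vertex_class G \<mu> d <+> F"
    by (auto simp: color_class_def vertex_class_def elems_def F_def)
  then have "card (color_class G \<mu> d) = card (vertex_class G \<mu> d) + card F"
    using fin by (simp add: card_Plus vertex_class_def)
  with n show ?thesis by simp
qed

text \<open>Count the pairs of a vertex and a neighbor of it in \<open>S\<close> from both ends.\<close>

lemma card_total_perfect_code:
  assumes G: "cubic_graph G" and S: "total_perfect_code G S"
  shows "3 * card S = card (verts G)"
proof -
  have fin: "finite (verts G)" and sub: "S \<subseteq> verts G"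
    using G S by (auto simp: cubic_graph_def total_perfect_code_def)
  have "(\<Sum>v\<in>verts G. card {s \<in> S. {v, s} \<in> edges G}) = 3 * card S"
  proof (rule sum_multicount)
    show "\<forall>s\<in>S. card {v \<in> verts G. {v, s} \<in> edges G} = 3"
      using G sub by (auto simp: cubic_graph_def nbhd_def insert_commute)
  qed (use fin sub finite_subset in auto)
  moreover have "{s \<in> S. {v, s} \<in> edges G} = nbhd G v \<inter> S" for v
    using sub by (auto simp: nbhd_def)
  ultimately show ?thesis
    using S by (simp add: total_perfect_code_def)
qed

theorem three_total_perfect_equitable_iff:
  assumes G: "cubic_graph G" and \<mu>: "three_total_perfect G \<mu>"
  shows "equitable G \<mu> \<longleftrightarrow> card (verts G) = 6"
proof -
  let ?C = "vertex_class G \<mu> ` colors - {{}}"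
  have stc: "semi_total_coloring G \<mu>"
    and C: "card ?C = 3" and code: "\<And>S. S \<in> ?C \<Longrightarrow> total_perfect_code G S"
    using \<mu> by (auto simp: three_total_perfect_def lacunar_def Let_def)
  obtain c where c: "c \<in> colors" "vertex_class G \<mu> c = {}"
    using \<mu> by (auto simp: three_total_perfect_def lacunar_def)
  have "?C \<noteq> {}" using C by (metis card.empty zero_neq_numeral)
  then obtain d where d: "d \<in> colors" "vertex_class G \<mu> d \<noteq> {}" by blast
  have size_empty: "2 * card (color_class G \<mu> x) = card (verts G)"
    if "x \<in> colors" "vertex_class G \<mu> x = {}" for x
    using double_card_color_class[OF G stc that(1)] that(2) by simp
  have size_code: "3 * card (color_class G \<mu> x) = 2 * card (verts G)"
    if "x \<in> colors" "vertex_class G \<mu> x \<noteq> {}" for x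
    using double_card_color_class[OF G stc that(1)] card_total_perfect_code[OF G code, of "vertex_class G \<mu> x"]
      that by auto
  have pos: "card (verts G) > 0"
    using d G by (auto simp: card_gt_0_iff vertex_class_def cubic_graph_def)
  show ?thesis
  proof
    assume "equitable G \<mu>"
    then have "card (color_class G \<mu> d) \<le> card (color_class G \<mu> c) + 1"
      using c d by (auto simp: equitable_def)
    then show "card (verts G) = 6"
      using size_empty[OF c] size_code[OF d] pos by presburger
  next
    assume six: "card (verts G) = 6"
    have between: "3 \<le> card (color_class G \<mu> x) \<and> card (color_class G \<mu> x) \<le> 4"
      if "x \<in> colors" for x
      using size_empty[OF that] size_code[OF that] six by (cases "vertex_class G \<mu> x = {}") auto
    show "equitable G \<mu>"
      unfolding equitable_def
    proof (intro ballI)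
      fix x y assume "x \<in> colors" "y \<in> colors"
      then show "card (color_class G \<mu> x) \<le> card (color_class G \<mu> y) + 1"
        using between[of x] between[of y] by simp
    qed
  qed
qed

section \<open>No reduction to a total coloring\<close>

text \<open>
  The exchange changes vertex colors at the two ends of the path only. One of the three codes
  contains neither end, and in it every vertex keeps a neighbor of its own color.
\<close>

theorem no_beta_reduction_to_total_coloring:
  assumes \<mu>: "three_total_perfect G \<mu>" and red: "beta_reduction G \<mu> \<mu>'"
  shows "\<not> total_coloring G \<mu>'"
proof
  assume tc: "total_coloring G \<mu>'"
  let ?C = "vertex_class G \<mu> ` colors - {{}}"
  obtain c0 c1 p where ex: "\<mu>' = exchange \<mu> c0 c1 p"
    using red by (auto simp: beta_reduction_def)
  have C: "card ?C = 3" and codes: "\<forall>S\<in>?C. total_perfect_code G S"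
    using \<mu> by (auto simp: three_total_perfect_def Let_def)
  let ?D = "{vertex_class G \<mu> (\<mu> (Inl (hd p))), vertex_class G \<mu> (\<mu> (Inl (last p)))}"
  have "card ?D \<le> 2" by (simp add: card_insert_if)
  then have "\<not> ?C \<subseteq> ?D"
    using card_mono[of ?D ?C] C by auto
  then obtain S where S: "S \<in> ?C" "S \<notin> ?D" by blast
  then obtain d where d: "S = vertex_class G \<mu> d" "d \<noteq> \<mu> (Inl (hd p))" "d \<noteq> \<mu> (Inl (last p))"
    by auto
  have same: "\<mu>' (Inl v) = d" if "v \<in> S" for v
    using that d by (auto simp: ex exchange_def swap_elems_def vertex_class_def)
  obtain v where v: "v \<in> S" using S by blast
  have "v \<in> verts G" "card (nbhd G v \<inter> S) = 1"
    using v S(1) codes by (auto simp: total_perfect_code_def)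
  moreover from this(2) obtain w where "w \<in> nbhd G v" "w \<in> S"
    by (metis Int_iff card_1_singletonE insertI1)
  ultimately show False
    using same v tc by (auto simp: total_coloring_def nbhd_def)
qed

section \<open>Colorings from rainbow neighborhoods\<close>

text \<open>
  On an edge with ends of different colors, the color is \<open>3 - (a + b) = 0 + 1 + 2 - (a + b)\<close>,
  which is the third of the colors \<open>0, 1, 2\<close>.
\<close>

definition rainbow_extension :: "('a \<Rightarrow> nat) \<Rightarrow> 'a coloring" where
  "rainbow_extension col x = (case x of Inl v \<Rightarrow> col v
     | Inr e \<Rightarrow> if card (col ` e) = 1 then 3 else 3 - \<Sum>(col ` e))"

lemma rainbow_extension_vertex: "rainbow_extension col (Inl v) = col v"
  by (simp add: rainbow_extension_def)

lemma rainbow_extension_edge: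
  "rainbow_extension col (Inr {u, v}) = (if col u = col v then 3 else 3 - (col u + col v))"
  by (simp add: rainbow_extension_def card_insert_if)

text \<open>
  At a vertex of color \<open>a\<close>, the color of the edge to a neighbor of color \<open>b\<close> is never \<open>a\<close> and
  determines \<open>b\<close>. Different edges at the vertex lead to different \<open>b\<close>, hence get different colors.
\<close>

lemma rainbow_extension_semi_total:
  assumes G: "cubic_graph G" and col: "\<And>v. v \<in> verts G \<Longrightarrow> col v < 3"
    and rainbow: "\<And>v. v \<in> verts G \<Longrightarrow> bij_betw col (nbhd G v) {..<3}"
  shows "semi_total_coloring G (rainbow_extension col)"
  unfolding semi_total_coloring_def
proof (intro conjI ballI impI)
  let ?\<mu> = "rainbow_extension col"
  show "?\<mu> \<in> elems G \<rightarrow> colors"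
  proof
    fix x assume x: "x \<in> elems G"
    show "?\<mu> x \<in> colors"
    proof (cases x)
      case (Inl v)
      then have "col v < 3" using x col by (auto simp: elems_def)
      then show ?thesis using Inl by (auto simp: rainbow_extension_vertex colors_def)
    next
      case (Inr e)
      then obtain u v where "e = {u, v}"
        using x G by (auto simp: elems_def cubic_graph_def)
      then show ?thesis using Inr by (auto simp: rainbow_extension_edge colors_def)
    qed
  qed
  show "?\<mu> (Inl v) \<noteq> ?\<mu> (Inr e)" if ev: "e \<in> edges G" "v \<in> e" for e v
  proof -
    obtain w where w: "e = {v, w}" "v \<in> verts G" "w \<in> nbhd G v"
      using cubic_graph_edgeE[OF G ev] by blast
    then have "col v < 3" "col w < 3" using col by (auto simp: nbhd_def)
    then show ?thesis
      unfolding w(1) rainbow_extension_vertex rainbow_extension_edge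
      by (auto simp: less_Suc_eq numeral_eq_Suc)
  qed
  show "?\<mu> (Inr e) \<noteq> ?\<mu> (Inr f)"
    if ef: "e \<in> edges G" "f \<in> edges G" "e \<noteq> f \<and> e \<inter> f \<noteq> {}" for e f
  proof -
    obtain v where v: "v \<in> e" "v \<in> f" using ef by blast
    obtain u where u: "e = {v, u}" "v \<in> verts G" "u \<in> nbhd G v"
      using cubic_graph_edgeE[OF G ef(1) v(1)] by blast
    obtain w where w: "f = {v, w}" "w \<in> nbhd G v"
      using cubic_graph_edgeE[OF G ef(2) v(2)] by blast
    have "u \<noteq> w" using ef(3) u w by blast
    then have "col u \<noteq> col w"
      using rainbow[OF u(2)] u w by (auto simp: bij_betw_def inj_on_def)
    moreover have "col v < 3" "col u < 3" "col w < 3"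
      using u w col by (auto simp: nbhd_def)
    ultimately show ?thesis
      unfolding u(1) w(1) rainbow_extension_edge
      by (auto simp: less_Suc_eq numeral_eq_Suc)
  qed
qed

text \<open>
  A rainbow neighborhood contains each of the colors \<open>0, 1, 2\<close> exactly once, so the vertex classes
  are total perfect codes. The neighbor of \<open>v\<close> with the color of \<open>v\<close> is the other end of the
  \<open>\<beta>\<close>-edge at \<open>v\<close>.
\<close>

theorem three_total_perfect_rainbow_extension:
  assumes G: "cubic_graph G" and ne: "verts G \<noteq> {}"
    and col: "\<And>v. v \<in> verts G \<Longrightarrow> col v < 3"
    and rainbow: "\<And>v. v \<in> verts G \<Longrightarrow> bij_betw col (nbhd G v) {..<3}"
  shows "three_total_perfect G (rainbow_extension col)"
proof -
  let ?\<mu> = "rainbow_extension col"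
  let ?V = "vertex_class G ?\<mu>"
  have V: "?V c = {v \<in> verts G. col v = c}" for c
    by (simp add: vertex_class_def rainbow_extension_vertex)
  have neighbor: "\<exists>w. nbhd G v \<inter> ?V c = {w}" if v: "v \<in> verts G" and c: "c < 3" for v c
  proof -
    obtain w where w: "w \<in> nbhd G v" "col w = c"
      using rainbow[OF v] c by (metis bij_betw_def imageE lessThan_iff)
    then have "nbhd G v \<inter> ?V c = {w}"
      using rainbow[OF v] by (auto simp: V nbhd_def bij_betw_def inj_on_def)
    then show ?thesis ..
  qed
  have nonempty: "?V c \<noteq> {}" if "c < 3" for c
    using neighbor[OF _ that] ne by blast
  have empty: "?V 3 = {}" using col by (fastforce simp: V)
  have classes: "?V ` colors - {{}} = ?V ` {..<3}"
  proof -
    have four: "colors = insert 3 {..<3}" by (auto simp: colors_def)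
    have "?V ` colors = insert {} (?V ` {..<3})" unfolding four image_insert empty ..
    then show ?thesis using nonempty by auto
  qed
  have "inj_on ?V {..<3}"
    by (rule inj_onI) (use nonempty in \<open>force simp: V\<close>)
  then have "card (?V ` {..<3}) = 3" by (simp add: card_image)
  moreover have "total_perfect_code G (?V c)" if "c < 3" for c
    using neighbor[OF _ that] by (auto simp: total_perfect_code_def card_1_singleton_iff V)
  moreover have "?V c = \<Union>{e \<in> beta_edges G ?\<mu>. e \<subseteq> ?V c}" if "c < 3" for c
  proof -
    have "v \<in> \<Union>{e \<in> beta_edges G ?\<mu>. e \<subseteq> ?V c}" if v: "v \<in> ?V c" for v
    proof -
      have "v \<in> verts G" using v by (simp add: V)
      then obtain w where "w \<in> nbhd G v" "w \<in> ?V c"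
        using neighbor[OF _ \<open>c < 3\<close>] by blast
      then have "{v, w} \<in> beta_edges G ?\<mu>" "{v, w} \<subseteq> ?V c"
        using v by (auto simp: beta_edges_def nbhd_def V rainbow_extension_vertex)
      then show ?thesis by blast
    qed
    then show ?thesis by blast
  qed
  moreover have "lacunar G ?\<mu>"
    unfolding lacunar_def
    using rainbow_extension_semi_total[OF G col rainbow] empty by (auto simp: colors_def)
  ultimately show ?thesis
    unfolding three_total_perfect_def Let_def classes by auto
qed

section \<open>Moebius ladders\<close>

lemma nbhd_Mob:
  assumes r: "r > 2" and v: "v < 2 * r"
  shows "nbhd (Mob r) v = {(v + 1) mod (2 * r), (v + (2 * r - 1)) mod (2 * r), (v + r) mod (2 * r)}"
    (is "_ = {?succ, ?pred, ?opp}")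
proof -
  have succ: "?succ = (if v + 1 = 2 * r then 0 else v + 1)" using v by auto
  have pred: "?pred = (if v = 0 then 2 * r - 1 else v - 1)" using v r
    by (auto simp: mod_if)
  have opp: "?opp = (if v < r then v + r else v - r)" using v r by (auto simp: mod_if)
  have edge: "{v, w} \<in> edges (Mob r) \<longleftrightarrow> w = (v + 1) mod (2 * r) \<or> v = (w + 1) mod (2 * r)
      \<or> w = v + r \<or> v = w + r" if "w < 2 * r" for w
    using v that by (auto simp: Mob_def doubleton_eq_iff)
  have "w \<in> nbhd (Mob r) v \<longleftrightarrow> w = ?succ \<or> w = ?pred \<or> w = ?opp" for w
  proof (cases "w < 2 * r")
    case True
    then have succ_w: "(w + 1) mod (2 * r) = (if w + 1 = 2 * r then 0 else w + 1)" by auto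
    have adj: "w \<in> nbhd (Mob r) v \<longleftrightarrow> {v, w} \<in> edges (Mob r)"
      using True by (simp add: nbhd_def Mob_def)
    show ?thesis
      unfolding adj edge[OF True] succ pred opp succ_w
      using True v r by (simp split: if_split; linarith)
  next
    case False
    then show ?thesis using v r unfolding succ pred opp
      by (auto simp: nbhd_def Mob_def)
  qed
  then show ?thesis by blast
qed

lemma card_verts_Mob: "card (verts (Mob r)) = 2 * r"
  by (simp add: Mob_def)

lemma cubic_graph_Mob:
  assumes r: "r > 2"
  shows "cubic_graph (Mob r)"
  unfolding cubic_graph_def
proof (intro conjI ballI)
  show "finite (verts (Mob r))" by (simp add: Mob_def)
next
  fix e assume "e \<in> edges (Mob r)"
  then consider i where "i < 2 * r" "e = {i, (i + 1) mod (2 * r)}" | i where "i < r" "e = {i, i + r}"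
    by (auto simp: Mob_def)
  then show "\<exists>u\<in>verts (Mob r). \<exists>v\<in>verts (Mob r). u \<noteq> v \<and> e = {u, v}"
  proof cases
    case 1
    then have "i \<noteq> (i + 1) mod (2 * r)" using r by (auto simp: mod_if)
    with 1 have "i \<in> verts (Mob r)" "(i + 1) mod (2 * r) \<in> verts (Mob r)"
      using r by (auto simp: Mob_def)
    with \<open>i \<noteq> (i + 1) mod (2 * r)\<close> 1 show ?thesis by blast
  next
    case 2
    then have "i \<in> verts (Mob r)" "i + r \<in> verts (Mob r)" "i \<noteq> i + r"
      using r by (auto simp: Mob_def)
    with 2 show ?thesis by blast
  qed
next
  fix v assume "v \<in> verts (Mob r)"
  then have v: "v < 2 * r" by (simp add: Mob_def)
  have "(v + 1) mod (2 * r) \<noteq> (v + (2 * r - 1)) mod (2 * r)"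
    "(v + 1) mod (2 * r) \<noteq> (v + r) mod (2 * r)"
    "(v + (2 * r - 1)) mod (2 * r) \<noteq> (v + r) mod (2 * r)"
    using v r by (auto simp: mod_if)
  then show "card (nbhd (Mob r) v) = 3"
    using nbhd_Mob[OF r v] by simp
qed

text \<open>
  Both \<open>6 * k\<close> and \<open>3 * k\<close> vanish modulo 3, so the three neighbors of \<open>v\<close> have the residues of
  \<open>v + 1\<close>, \<open>v - 1\<close> and \<open>v\<close>. The \<open>\<beta>\<close>-edges are the ones joining opposite vertices.
\<close>

lemma Mob_residue_rainbow:
  assumes k: "k \<ge> 1" and v: "v \<in> verts (Mob (3 * k))"
  shows "bij_betw (\<lambda>v. v mod 3) (nbhd (Mob (3 * k)) v) {..<3}"
proof -
  have r: "3 * k > 2" using k by linarith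
  have v': "v < 2 * (3 * k)" using v by (simp add: Mob_def)
  have cancel: "x mod (2 * (3 * k)) mod 3 = x mod 3" for x :: nat
    by (simp add: mod_mod_cancel)
  have "2 * (3 * k) - 1 = 3 * (2 * k - 1) + 2" using k by simp
  then have pred: "(v + (2 * (3 * k) - 1)) mod 3 = (v + 2) mod 3"
    by (metis add.assoc add.commute mod_mult_self2)
  have "(\<lambda>v. v mod 3) ` nbhd (Mob (3 * k)) v = {(v + 1) mod 3, (v + 2) mod 3, v mod 3}"
    unfolding nbhd_Mob[OF r v'] by (simp only: image_insert image_empty cancel pred) simp
  also have "\<dots> = {..<3}"
  proof -
    have "v mod 3 = 0 \<or> v mod 3 = 1 \<or> v mod 3 = 2" by linarith
    then show ?thesis by (auto simp: mod_add_eq mod_Suc lessThan_nat_numeral lessThan_Suc)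
  qed
  finally have img: "(\<lambda>v. v mod 3) ` nbhd (Mob (3 * k)) v = {..<3}" .
  have "card (nbhd (Mob (3 * k)) v) = 3"
    using cubic_graph_Mob[OF r] v by (simp add: cubic_graph_def)
  then show ?thesis
    using img by (auto simp: bij_betw_def card_ge_0_finite intro!: eq_card_imp_inj_on)
qed

lemma Mob_three_total_perfect:
  assumes k: "k \<ge> 1"
  shows "three_total_perfect (Mob (3 * k)) (rainbow_extension (\<lambda>v. v mod 3))"
proof (rule three_total_perfect_rainbow_extension)
  show "cubic_graph (Mob (3 * k))" using k by (intro cubic_graph_Mob) simp
  show "verts (Mob (3 * k)) \<noteq> {}" using k by (simp add: Mob_def lessThan_empty_iff)
qed (use Mob_residue_rainbow[OF k] in auto)

text \<open>
  The differences \<open>1\<close>, \<open>3\<close>, \<open>5\<close> of adjacent vertices are all the odd residues modulo 6, so the even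
  and the odd vertices are the two sides of the complete bipartite graph.
\<close>

lemma Mob_3_adjacent_iff_parity:
  assumes "u < 6" "v < 6"
  shows "{u, v} \<in> edges (Mob 3) \<longleftrightarrow> even u \<noteq> even v"
proof -
  have "v \<in> verts (Mob 3)" using assms by (simp add: Mob_def)
  then have "{u, v} \<in> edges (Mob 3) \<longleftrightarrow> v \<in> nbhd (Mob 3) u"
    by (simp only: nbhd_def mem_Collect_eq simp_thms)
  also have "\<dots> \<longleftrightarrow> v = (u + 1) mod 6 \<or> v = (u + 5) mod 6 \<or> v = (u + 3) mod 6"
    using nbhd_Mob[of 3 u] assms by simp
  also have "\<dots> \<longleftrightarrow> even u \<noteq> even v"
  proof -
    have "u = 0 \<or> u = 1 \<or> u = 2 \<or> u = 3 \<or> u = 4 \<or> u = 5"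
      and "v = 0 \<or> v = 1 \<or> v = 2 \<or> v = 3 \<or> v = 4 \<or> v = 5"
      using assms by linarith+
    then show ?thesis by (elim disjE) simp_all
  qed
  finally show ?thesis .
qed

lemma complete_bipartite_3_3_iso_Mob_3: "graph_iso (complete_bipartite 3 3) (Mob 3)"
proof -
  let ?f = "case_sum (\<lambda>i. 2 * i) (\<lambda>j. 2 * j + 1) :: nat + nat \<Rightarrow> nat"
  have V: "verts (complete_bipartite 3 3) = {..<3} <+> {..<3}"
    by (simp add: complete_bipartite_def)
  have inj: "inj_on ?f ({..<3} <+> {..<3})"
  proof (rule inj_onI)
    fix x y assume "?f x = ?f y"
    then show "x = y" by (cases x; cases y; simp; presburger)
  qed
  have lt: "?f x < 6" if "x \<in> {..<3} <+> {..<3}" for x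
    using that by auto
  then have "?f ` ({..<3} <+> {..<3}) = {..<6}"
    using inj by (intro card_subset_eq) (auto simp: card_image card_Plus)
  moreover have "verts (Mob 3) = {..<6}" by (simp add: Mob_def)
  ultimately have bij: "bij_betw ?f (verts (complete_bipartite 3 3)) (verts (Mob 3))"
    using inj unfolding V by (simp only: bij_betw_def simp_thms)
  have "{u, v} \<in> edges (complete_bipartite 3 3) \<longleftrightarrow> {?f u, ?f v} \<in> edges (Mob 3)"
    if u: "u \<in> {..<3} <+> {..<3}" and v: "v \<in> {..<3} <+> {..<3}" for u v
    unfolding Mob_3_adjacent_iff_parity[OF lt[OF u] lt[OF v]]
    using u v by (auto simp: complete_bipartite_def doubleton_eq_iff)
  with bij show ?thesis unfolding graph_iso_def V by blast
qed

theorem corollary37: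
  shows "(\<forall>k::nat. k \<ge> 1 \<longrightarrow>
       (\<exists>\<mu>. three_total_perfect (Mob (3 * k)) \<mu> \<and>
          \<not> (\<exists>\<mu>'. beta_reduction (Mob (3 * k)) \<mu> \<mu>' \<and> total_coloring (Mob (3 * k)) \<mu>')) \<and>
       (\<forall>\<mu>. three_total_perfect (Mob (3 * k)) \<mu> \<and>
          \<not> (\<exists>\<mu>'. beta_reduction (Mob (3 * k)) \<mu> \<mu>' \<and> total_coloring (Mob (3 * k)) \<mu>') \<longrightarrow>
          (equitable (Mob (3 * k)) \<mu> \<longleftrightarrow> k = 1))) \<and>
    graph_iso (complete_bipartite 3 3) (Mob 3) \<and>
    (\<forall>r::nat. r > 2 \<longrightarrow>
       ((\<exists>\<mu>. three_total_perfect (Mob r) \<mu> \<and> equitable (Mob r) \<mu>) \<longleftrightarrow> r = 3))"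
proof -
  have equitable_iff: "equitable (Mob r) \<mu> \<longleftrightarrow> r = 3"
    if "r > 2" "three_total_perfect (Mob r) \<mu>" for r \<mu>
    using three_total_perfect_equitable_iff[OF cubic_graph_Mob[OF that(1)] that(2)]
    by (auto simp: card_verts_Mob)
  have "\<exists>\<mu>. three_total_perfect (Mob (3 * k)) \<mu>" if "k \<ge> 1" for k
    using Mob_three_total_perfect[OF that] by blast
  moreover from this[of 1] have "\<exists>\<mu>. three_total_perfect (Mob 3) \<mu>" by simp
  moreover have "equitable (Mob (3 * k)) \<mu> \<longleftrightarrow> k = 1"
    if "k \<ge> 1" "three_total_perfect (Mob (3 * k)) \<mu>" for k \<mu>
    using equitable_iff[of "3 * k"] that by simp
  ultimately show ?thesis
    using equitable_iff no_beta_reduction_to_total_coloring complete_bipartite_3_3_iso_Mob_3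
    by (intro conjI allI impI) blast+
qed

end
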